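(* Let $\vec n_1^*,\vec n_2^*,\vec n_3^*\in\mathbb{R}^3$ be unit vectors whose configuration is asymmetric, i.e. the three numbers $|\vec n_1^*-\vec n_2^*|$, $|\vec n_1^*-\vec n_3^*|$, $|\vec n_2^*-\vec n_3^*|$ are pairwise distinct. For each $(i,j)\in\{(1,2),(1,3),(2,3)\}$ let $\omega_{ij}\in[0,1]$ be the solution of $$\vec n_i^*\cdot\vec n_j^*=\frac{2\omega_{ij}-1}{\omega_{ij}^2+(1-\omega_{ij})^2}.$$ Then the triple of pure states with Bloch vectors $\vec n_1^*,\vec n_2^*,\vec n_3^*$ violates the mirror-symmetric bound of $I_6(\omega_{12},\omega_{13},\omega_{23})$: there exist qubit states $\rho_4,\rho_5,\rho_6$ and two-outcome qubit observables $B_1,\dots,B_6$ such that, with $\rho_x$ for $x=1,2,3$ the pure state with Bloch vector $\vec n_x^*$, the value of $I_6(\omega_{12},\omega_{13},\omega_{23})$ is strictly greater than $Q_{\mathrm{mirror}}(\omega_{12},\omega_{13},\omega_{23})$.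
   Context: A qubit state is a density matrix $\rho=\tfrac12(\mathbb{I}_2+\vec n\cdot\vec\sigma)$ with Bloch vector $\vec n\in\mathbb{R}^3$, $|\vec n|\le 1$ ($\vec\sigma$ is the vector of Pauli matrices); it is pure iff $|\vec n|=1$. A two-outcome qubit observable is $B=M_0-M_1$, where $M_0,M_1$ are positive semidefinite $2\times2$ matrices with $M_0+M_1=\mathbb{I}_2$. Given states $\rho_x$ and observables $B_y$, put $E_{x,y}=\mathrm{Tr}(\rho_xB_y)$. For $\omega\in[0,1]$ define $$I_3(\omega;i_1,i_2,i_3,j_1,j_2)=\omega(E_{i_1,j_1}+E_{i_2,j_1}-E_{i_3,j_1})+(1-\omega)(E_{i_1,j_2}-E_{i_2,j_2}),$$ and $$I_6(\omega_{12},\omega_{13},\omega_{23})=I_3(\omega_{12};1,2,4,1,2)+I_3(\omega_{13};1,3,5,3,4)+I_3(\omega_{23};2,3,6,5,6).$$ The map $\omega\mapsto\frac{2\omega-1}{\omega^2+(1-\omega)^2}$ is strictly increasing from $-1$ to $1$ on $[0,1]$, so each $\omega_{ij}$ is well defined and unique. A triple of (possibly mixed) qubit states with Bloch vectors $\vec n_1,\vec n_2,\vec n_3$ is mirror-symmetric if at least two of the three numbers $|\vec n_1-\vec n_2|$, $|\vec n_1-\vec n_3|$, $|\vec n_2-\vec n_3|$ are equal. The mirror-symmetric bound $Q_{\mathrm{mirror}}(\omega_{12},\omega_{13},\omega_{23})$ is the maximum of $I_6(\omega_{12},\omega_{13},\omega_{23})$ over all qubit states $\rho_1,\dots,\rho_6$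 such that $(\rho_1,\rho_2,\rho_3)$ is mirror-symmetric and over all two-outcome qubit observables $B_1,\dots,B_6$. *)

theory Defs
  imports "HOL-Analysis.Analysis"
begin

type_synonym cmat2 = "complex^2^2"

definition pauli_x :: cmat2 where
  "pauli_x = vector [vector [0, 1], vector [1, 0]]"

definition pauli_y :: cmat2 where
  "pauli_y = vector [vector [0, - \<i>], vector [\<i>, 0]]"

definition pauli_z :: cmat2 where
  "pauli_z = vector [vector [1, 0], vector [0, -1]]"

definition bloch_matrix :: "real^3 \<Rightarrow> cmat2" where
  "bloch_matrix n =
     (1/2) *\<^sub>R (mat 1 + n$1 *\<^sub>R pauli_x + n$2 *\<^sub>R pauli_y + n$3 *\<^sub>R pauli_z)"

definition has_bloch_vector :: "cmat2 \<Rightarrow> real^3 \<Rightarrow> bool" where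
  "has_bloch_vector \<rho> n \<longleftrightarrow> norm n \<le> 1 \<and> \<rho> = bloch_matrix n"

definition qubit_state :: "cmat2 \<Rightarrow> bool" where
  "qubit_state \<rho> \<longleftrightarrow> (\<exists>n. has_bloch_vector \<rho> n)"

definition positive_semidefinite :: "cmat2 \<Rightarrow> bool" where
  "positive_semidefinite M \<longleftrightarrow>
     (\<forall>i j. M$i$j = cnj (M$j$i)) \<and>
     (\<forall>v :: complex^2. 0 \<le> Re (\<Sum>i\<in>UNIV. \<Sum>j\<in>UNIV. cnj (v$i) * M$i$j * v$j))"

definition two_outcome_observable :: "cmat2 \<Rightarrow> bool" where
  "two_outcome_observable B \<longleftrightarrow>
     (\<exists>M0 M1. positive_semidefinite M0 \<and> positive_semidefinite M1 \<and>
        M0 + M1 = mat 1 \<and> B = M0 - M1)"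

text \<open>Families of states and observables are indexed by \<open>1, \<dots>, 6\<close>; values at other indices
  are irrelevant. The trace of a product of two Hermitian matrices is real, so \<open>Re\<close> loses
  nothing.\<close>

definition correlator :: "(nat \<Rightarrow> cmat2) \<Rightarrow> (nat \<Rightarrow> cmat2) \<Rightarrow> nat \<Rightarrow> nat \<Rightarrow> real" where
  "correlator \<rho> B x y = Re (trace (\<rho> x ** B y))"

definition I3 :: "(nat \<Rightarrow> cmat2) \<Rightarrow> (nat \<Rightarrow> cmat2) \<Rightarrow> real \<Rightarrow>
    nat \<Rightarrow> nat \<Rightarrow> nat \<Rightarrow> nat \<Rightarrow> nat \<Rightarrow> real" where
  "I3 \<rho> B \<omega> i1 i2 i3 j1 j2 =
     \<omega> * (correlator \<rho> B i1 j1 + correlator \<rho> B i2 j1 - correlator \<rho> B i3 j1) +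
     (1 - \<omega>) * (correlator \<rho> B i1 j2 - correlator \<rho> B i2 j2)"

definition I6 :: "(nat \<Rightarrow> cmat2) \<Rightarrow> (nat \<Rightarrow> cmat2) \<Rightarrow> real \<Rightarrow> real \<Rightarrow> real \<Rightarrow> real" where
  "I6 \<rho> B \<omega>12 \<omega>13 \<omega>23 =
     I3 \<rho> B \<omega>12 1 2 4 1 2 + I3 \<rho> B \<omega>13 1 3 5 3 4 + I3 \<rho> B \<omega>23 2 3 6 5 6"

definition mirror_symmetric :: "cmat2 \<Rightarrow> cmat2 \<Rightarrow> cmat2 \<Rightarrow> bool" where
  "mirror_symmetric \<rho>1 \<rho>2 \<rho>3 \<longleftrightarrow>
     (\<exists>n1 n2 n3. has_bloch_vector \<rho>1 n1 \<and> has_bloch_vector \<rho>2 n2 \<and> has_bloch_vector \<rho>3 n3 \<and>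
        (norm (n1 - n2) = norm (n1 - n3) \<or>
         norm (n1 - n2) = norm (n2 - n3) \<or>
         norm (n1 - n3) = norm (n2 - n3)))"

definition mirror_values :: "real \<Rightarrow> real \<Rightarrow> real \<Rightarrow> real set" where
  "mirror_values \<omega>12 \<omega>13 \<omega>23 =
     {I6 \<rho> B \<omega>12 \<omega>13 \<omega>23 | \<rho> B.
        (\<forall>x\<in>{1..6}. qubit_state (\<rho> x)) \<and>
        mirror_symmetric (\<rho> 1) (\<rho> 2) (\<rho> 3) \<and>
        (\<forall>y\<in>{1..6}. two_outcome_observable (B y))}"

text \<open>\<open>GREATEST\<close> is a description operator: its value is only determined because the maximum
  is attained (the value set is a continuous image of a compact set).\<close>

definition Q_mirror :: "real \<Rightarrow> real \<Rightarrow> real \<Rightarrow> real" where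
  "Q_mirror \<omega>12 \<omega>13 \<omega>23 = (GREATEST q. q \<in> mirror_values \<omega>12 \<omega>13 \<omega>23)"

lemma bloch_matrix_nth:
  "bloch_matrix n $ 1 $ 1 = Complex ((1 + n$3) / 2) 0"
  "bloch_matrix n $ 1 $ 2 = Complex (n$1 / 2) (- (n$2 / 2))"
  "bloch_matrix n $ 2 $ 1 = Complex (n$1 / 2) (n$2 / 2)"
  "bloch_matrix n $ 2 $ 2 = Complex ((1 - n$3) / 2) 0"
  by (simp_all add: bloch_matrix_def pauli_x_def pauli_y_def pauli_z_def mat_def complex_eq_iff)

lemma norm3_sq: "(norm (n :: real^3))\<^sup>2 = (n$1)\<^sup>2 + (n$2)\<^sup>2 + (n$3)\<^sup>2"
  unfolding power2_norm_eq_inner by (simp add: inner_vec_def sum_3 power2_eq_square)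

lemma bloch_form:
  fixes v :: "complex^2"
  shows "2 * Re (\<Sum>i\<in>UNIV. \<Sum>j\<in>UNIV. cnj (v$i) * bloch_matrix n$i$j * v$j) =
    (1 + n$3) * ((Re (v$1))\<^sup>2 + (Im (v$1))\<^sup>2) + (1 - n$3) * ((Re (v$2))\<^sup>2 + (Im (v$2))\<^sup>2)
    + 2 * n$1 * (Re (v$1) * Re (v$2) + Im (v$1) * Im (v$2))
    + 2 * n$2 * (Re (v$1) * Im (v$2) - Im (v$1) * Re (v$2))"
proof -
  obtain a b where v1: "v$1 = Complex a b" by (cases "v$1")
  obtain c d where v2: "v$2 = Complex c d" by (cases "v$2")
  define p q r s where "p = (1 + n$3) / 2" and "q = (1 - n$3) / 2" and "r = n$1 / 2" and "s = n$2 / 2"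
  have e: "1 + n$3 = 2 * p" "1 - n$3 = 2 * q" "n$1 = 2 * r" "n$2 = 2 * s"
    by (simp_all add: p_def q_def r_def s_def)
  show ?thesis
    unfolding sum_2 bloch_matrix_nth v1 v2 e
    by (simp add: power2_eq_square algebra_simps)
qed

text \<open>Qubit states are exactly the density matrices.\<close>

lemma qubit_state_iff: "qubit_state \<rho> \<longleftrightarrow> positive_semidefinite \<rho> \<and> trace \<rho> = 1"
proof
  assume "qubit_state \<rho>"
  then obtain n where n: "norm n \<le> 1" "\<rho> = bloch_matrix n"
    by (auto simp: qubit_state_def has_bloch_vector_def)
  define x y z where "x = n$1" and "y = n$2" and "z = n$3"
  have le: "x\<^sup>2 + y\<^sup>2 + z\<^sup>2 \<le> 1"
    using power_le_one[OF norm_ge_zero n(1), of 2] norm3_sq[of n] by (simp add: x_def y_def z_def)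
  have "0 \<le> Re (\<Sum>i\<in>UNIV. \<Sum>j\<in>UNIV. cnj (v$i) * \<rho>$i$j * v$j)" for v :: "complex^2"
  proof -
    define a b c d where "a = Re (v$1)" and "b = Im (v$1)" and "c = Re (v$2)" and "d = Im (v$2)"
    define Q where "Q = Re (\<Sum>i\<in>UNIV. \<Sum>j\<in>UNIV. cnj (v$i) * \<rho>$i$j * v$j)"
    have Q: "2 * Q = (1+z) * (a\<^sup>2+b\<^sup>2) + (1-z) * (c\<^sup>2+d\<^sup>2) + 2*x*(a*c+b*d) + 2*y*(a*d-b*c)"
      unfolding n(2) Q_def a_def b_def c_def d_def x_def y_def z_def by (rule bloch_form)
    have "2 * (2 * Q) = ((1+z)*a + x*c + y*d)\<^sup>2 + ((1+z)*b + x*d - y*c)\<^sup>2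
        + ((1-z)*c + x*a - y*b)\<^sup>2 + ((1-z)*d + x*b + y*a)\<^sup>2
        + (1 - (x\<^sup>2+y\<^sup>2+z\<^sup>2)) * (a\<^sup>2+b\<^sup>2+c\<^sup>2+d\<^sup>2)"
      unfolding Q by (simp add: power2_eq_square algebra_simps)
    moreover have "0 \<le> (1 - (x\<^sup>2+y\<^sup>2+z\<^sup>2)) * (a\<^sup>2+b\<^sup>2+c\<^sup>2+d\<^sup>2)"
      using le by (intro mult_nonneg_nonneg) auto
    ultimately have "0 \<le> 2 * (2 * Q)"
      by (simp only: add_nonneg_nonneg zero_le_power2)
    then show ?thesis by (simp add: Q_def)
  qed
  moreover have "\<forall>i j. \<rho>$i$j = cnj (\<rho>$j$i)"
    by (simp add: forall_2 n(2) bloch_matrix_nth complex_eq_iff)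
  moreover have "trace \<rho> = 1"
    by (simp add: trace_def sum_2 n(2) bloch_matrix_nth complex_eq_iff field_simps)
  ultimately show "positive_semidefinite \<rho> \<and> trace \<rho> = 1"
    unfolding positive_semidefinite_def by blast
next
  assume a: "positive_semidefinite \<rho> \<and> trace \<rho> = 1"
  then have herm: "\<rho>$i$j = cnj (\<rho>$j$i)" for i j
    unfolding positive_semidefinite_def by blast
  have pos: "0 \<le> Re (\<Sum>i\<in>UNIV. \<Sum>j\<in>UNIV. cnj (v$i) * \<rho>$i$j * v$j)" for v :: "complex^2"
    using a unfolding positive_semidefinite_def by blast
  define n :: "real^3" where
    "n = vector [2 * Re (\<rho>$2$1), 2 * Im (\<rho>$2$1), 2 * Re (\<rho>$1$1) - 1]"
  have tr: "\<rho>$1$1 + \<rho>$2$2 = 1" using a by (simp add: trace_def sum_2)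
  have im: "Im (\<rho>$1$1) = 0" "Im (\<rho>$2$2) = 0"
    using arg_cong[OF herm[of 1 1], of Im] arg_cong[OF herm[of 2 2], of Im] by simp_all
  have re: "Re (\<rho>$2$2) = 1 - Re (\<rho>$1$1)" using tr by (simp add: complex_eq_iff)
  have eq: "\<rho> = bloch_matrix n"
    using im re arg_cong[OF herm[of 1 2], of Re] arg_cong[OF herm[of 1 2], of Im]
    by (simp add: vec_eq_iff forall_2 bloch_matrix_nth n_def complex_eq_iff)
  define x y z where "x = n$1" and "y = n$2" and "z = n$3"
  have "0 \<le> (1+z) * (1 - (x\<^sup>2+y\<^sup>2+z\<^sup>2))"
    using mult_nonneg_nonneg[of 2, OF _ pos[of "vector [Complex (-x) y, Complex (1+z) 0]"]]
    unfolding eq bloch_form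
    by (simp add: x_def y_def z_def power2_eq_square algebra_simps)
  moreover have "0 \<le> (1-z) * (1 - (x\<^sup>2+y\<^sup>2+z\<^sup>2))"
    using mult_nonneg_nonneg[of 2, OF _ pos[of "vector [Complex (1-z) 0, Complex (-x) (-y)]"]]
    unfolding eq bloch_form
    by (simp add: x_def y_def z_def power2_eq_square algebra_simps)
  ultimately have "x\<^sup>2+y\<^sup>2+z\<^sup>2 \<le> 1" by (simp add: algebra_simps)
  then have "(norm n)\<^sup>2 \<le> 1" by (simp add: norm3_sq x_def y_def z_def)
  then have "norm n \<le> 1" by (simp add: abs_square_le_1)
  with eq show "qubit_state \<rho>" by (auto simp: qubit_state_def has_bloch_vector_def)
qed

end

theory Submission
  imports Defs
begin

text \<open>
  A two-outcome observable acts on Bloch vectors as an affine map \<open>n \<mapsto> a + b \<bullet> n\<close> with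
  \<open>\<bar>a\<bar> + norm b \<le> 1\<close>, so optimising \<open>I3\<close> over the observables and the third state leaves
  \<open>\<omega> (1 + norm (n + m)) + (1 - \<omega>) norm (n - m)\<close>. By the Cauchy-Schwarz inequality and the
  parallelogram law this is at most \<open>\<omega> + 2 sqrt (\<omega>\<^sup>2 + (1 - \<omega>)\<^sup>2)\<close>, and equality forces
  \<open>norm (n - m) = 2 (1 - \<omega>) / sqrt (\<omega>\<^sup>2 + (1 - \<omega>)\<^sup>2)\<close>. The asymmetric triple attains all three
  bounds at once; a triple that did so as well would have the same three distances and could not
  be mirror-symmetric. Since the mirror-symmetric maximum is attained, the gap is strict.
\<close>

section \<open>Observables as affine functions of the Bloch vector\<close>

lemma trace_bloch_mult:
  "Re (trace (bloch_matrix n ** M)) =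
     (Re (M$1$1) + Re (M$2$2)) / 2 + n$1 * (Re (M$1$2) + Re (M$2$1)) / 2
     + n$2 * (Im (M$2$1) - Im (M$1$2)) / 2 + n$3 * (Re (M$1$1) - Re (M$2$2)) / 2"
  by (simp add: trace_def matrix_matrix_mult_def sum_2 bloch_matrix_nth field_simps)

text \<open>Writing \<open>M\<close> as \<open>t\<close> times the identity plus \<open>m\<close>
  dotted with the Pauli matrices gives it the determinant
  \<open>t\<^sup>2 - (norm m)\<^sup>2\<close>. Nonnegativity of this and of \<open>t\<close> is the
  norm bound.\<close>

lemma positive_semidefinite_trace_bloch:
  assumes "positive_semidefinite M"
  obtains t and m :: "real^3" where "norm m \<le> t"
    and "\<And>n. Re (trace (bloch_matrix n ** M)) = t + m \<bullet> n"
proof -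
  define p q r s where "p = Re (M$1$1)" and "q = Re (M$2$2)"
    and "r = Re (M$2$1)" and "s = Im (M$2$1)"
  have herm: "M$i$j = cnj (M$j$i)" for i j
    using assms unfolding positive_semidefinite_def by blast
  have entries: "M$1$1 = Complex p 0" "M$2$2 = Complex q 0"
    "M$2$1 = Complex r s" "M$1$2 = Complex r (- s)"
    using herm[of 1 1] herm[of 2 2] herm[of 1 2]
    by (simp_all add: p_def q_def r_def s_def complex_eq_iff)
  have form: "0 \<le> Re (\<Sum>i\<in>UNIV. \<Sum>j\<in>UNIV. cnj (v$i) * M$i$j * v$j)" for v :: "complex^2"
    using assms unfolding positive_semidefinite_def by blast
  have p0: "0 \<le> p"
    using form[of "vector [1, 0]"] by (simp add: sum_2 entries)
  have q0: "0 \<le> q"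
    using form[of "vector [0, 1]"] by (simp add: sum_2 entries)
  \<comment> \<open>The test vectors here and in the next step are the columns of the adjugate of
    \<open>M\<close>; on them the form equals the determinant times \<open>q\<close> or
    \<open>p\<close>.\<close>
  have "0 \<le> q * (p * q - (r\<^sup>2 + s\<^sup>2))"
    using form[of "vector [Complex q 0, Complex (- r) (- s)]"]
    by (simp add: sum_2 entries power2_eq_square algebra_simps)
  moreover have "0 \<le> p * (p * q - (r\<^sup>2 + s\<^sup>2))"
    using form[of "vector [Complex (- r) s, Complex p 0]"]
    by (simp add: sum_2 entries power2_eq_square algebra_simps)
  ultimately have pq: "0 \<le> (p + q) * (p * q - (r\<^sup>2 + s\<^sup>2))"
    by (simp add: algebra_simps)
  \<comment> \<open>With a zero diagonal the adjugate columns only give \<open>0 \<le> 0\<close>;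
    this vector makes the form equal to \<open>- 2 * (r\<^sup>2 + s\<^sup>2)\<close>.\<close>
  have "r\<^sup>2 + s\<^sup>2 \<le> 0" if "p = 0" "q = 0"
    using form[of "vector [Complex (- r) s, 1]"] that
    by (simp add: sum_2 entries power2_eq_square algebra_simps)
  moreover have "p + q = 0 \<longleftrightarrow> p = 0 \<and> q = 0"
    using p0 q0 by (rule add_nonneg_eq_0_iff)
  ultimately have "r\<^sup>2 + s\<^sup>2 \<le> p * q" if "p + q = 0"
    using that by simp
  moreover have "r\<^sup>2 + s\<^sup>2 \<le> p * q" if "p + q \<noteq> 0"
  proof -
    have "0 < p + q" using that p0 q0 by simp
    then show ?thesis using pq by (simp add: zero_le_mult_iff)
  qed
  ultimately have det: "r\<^sup>2 + s\<^sup>2 \<le> p * q" by blast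
  define m :: "real^3" where "m = vector [r, s, (p - q) / 2]"
  have "(norm m)\<^sup>2 \<le> ((p + q) / 2)\<^sup>2"
    unfolding norm3_sq using det by (simp add: m_def power2_eq_square field_simps)
  then have "norm m \<le> (p + q) / 2"
    by (rule power2_le_imp_le) (use p0 q0 in simp)
  moreover have "Re (trace (bloch_matrix n ** M)) = (p + q) / 2 + m \<bullet> n" for n
    by (simp add: trace_bloch_mult entries m_def inner_vec_def sum_3 field_simps)
  ultimately show thesis by (rule that)
qed

text \<open>The two effects carry opposite vectors \<open>m0\<close> and \<open>- m0\<close>, and
  weights that sum to 1 and are both at least \<open>norm m0\<close>. So
  \<open>\<bar>t0 - t1\<bar>\<close>, which is 1 minus twice the smaller weight, leaves room for
  \<open>norm (m0 - m1) = 2 * norm m0\<close>.\<close>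

lemma two_outcome_observable_affine:
  assumes "two_outcome_observable B"
  obtains a and b :: "real^3" where "\<bar>a\<bar> + norm b \<le> 1"
    and "\<And>n. Re (trace (bloch_matrix n ** B)) = a + b \<bullet> n"
proof -
  obtain M0 M1 where M: "positive_semidefinite M0" "positive_semidefinite M1"
      "M0 + M1 = mat 1" "B = M0 - M1"
    using assms by (auto simp: two_outcome_observable_def)
  obtain t0 m0 where 0: "norm m0 \<le> t0" "\<And>n. Re (trace (bloch_matrix n ** M0)) = t0 + m0 \<bullet> n"
    using positive_semidefinite_trace_bloch[OF M(1)] by metis
  obtain t1 m1 where 1: "norm m1 \<le> t1" "\<And>n. Re (trace (bloch_matrix n ** M1)) = t1 + m1 \<bullet> n"
    using positive_semidefinite_trace_bloch[OF M(2)] by metis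
  \<comment> \<open>\<open>bloch_matrix n\<close> has trace 1 for every \<open>n\<close>, also
    outside the unit ball, so \<open>n\<close> can be chosen freely: 0 isolates the weights, and
    \<open>m0 + m1\<close> turns the inner product into a squared norm.\<close>
  have one: "t0 + t1 + (m0 + m1) \<bullet> n = 1" for n
  proof -
    have "Re (trace (bloch_matrix n ** (M0 + M1))) = 1"
      by (simp add: M(3) trace_bloch_mult mat_def)
    then show ?thesis
      by (simp add: matrix_add_ldistrib trace_add 0(2) 1(2) inner_left_distrib)
  qed
  have t: "t0 + t1 = 1" using one[of 0] by simp
  have "m0 + m1 = 0" using one[of "m0 + m1"] t by simp
  then have m: "m1 = - m0" by (simp add: eq_neg_iff_add_eq_0 add.commute)
  have "norm (m0 - m1) = 2 * norm m0"
    unfolding m by (simp flip: scaleR_2)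
  then have "\<bar>t0 - t1\<bar> + norm (m0 - m1) \<le> 1"
    using 0(1) 1(1) t by (simp add: m)
  moreover have "Re (trace (bloch_matrix n ** B)) = (t0 - t1) + (m0 - m1) \<bullet> n" for n
  proof -
    have "Re (trace (bloch_matrix n ** (M0 - M1))) =
        Re (trace (bloch_matrix n ** M0)) - Re (trace (bloch_matrix n ** M1))"
      by (simp add: trace_bloch_mult field_simps)
    then show ?thesis
      by (simp add: M(4) 0(2) 1(2) inner_diff_left)
  qed
  ultimately show thesis by (rule that)
qed

text \<open>This is \<open>m\<close> dotted with the Pauli matrices. The difference of antipodal
  Bloch matrices displays the two effects, whose positivity then follows from
  \<open>qubit_state_iff\<close>.\<close>

definition spin_observable :: "real^3 \<Rightarrow> cmat2" where
  "spin_observable m = bloch_matrix m - bloch_matrix (- m)"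

lemma two_outcome_observable_spin:
  assumes "norm m \<le> 1"
  shows "two_outcome_observable (spin_observable m)"
proof -
  have "qubit_state (bloch_matrix m)" "qubit_state (bloch_matrix (- m))"
    using assms by (auto simp: qubit_state_def has_bloch_vector_def intro: exI[of _ "- m"])
  then have "positive_semidefinite (bloch_matrix m)" "positive_semidefinite (bloch_matrix (- m))"
    by (simp_all add: qubit_state_iff)
  moreover have "bloch_matrix m + bloch_matrix (- m) = mat 1"
    by (simp add: vec_eq_iff forall_2 bloch_matrix_nth mat_def complex_eq_iff field_simps)
  ultimately show ?thesis
    unfolding two_outcome_observable_def spin_observable_def by blast
qed

lemma trace_bloch_spin: "Re (trace (bloch_matrix n ** spin_observable m)) = m \<bullet> n"
  by (simp add: trace_bloch_mult spin_observable_def bloch_matrix_nth inner_vec_def sum_3 field_simps)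

section \<open>Eliminating the observables and the auxiliary states\<close>

definition pair_bound :: "real \<Rightarrow> real^3 \<Rightarrow> real^3 \<Rightarrow> real" where
  "pair_bound \<omega> n m = \<omega> * (1 + norm (n + m)) + (1 - \<omega>) * norm (n - m)"

text \<open>The offset of \<open>B z\<close> cancels, while that of \<open>B y\<close> survives
  once. The budget \<open>\<bar>a\<bar> + norm b \<le> 1\<close> is spent on
  \<open>a - b \<bullet> l\<close>; Cauchy-Schwarz handles the sum and the difference of
  \<open>n\<close> and \<open>m\<close>.\<close>

lemma I3_le_pair_bound:
  assumes "\<omega> \<in> {0..1}" and "\<rho> i = bloch_matrix n" and "\<rho> j = bloch_matrix m"
    and "qubit_state (\<rho> k)" and "two_outcome_observable (B y)" and "two_outcome_observable (B z)"
  shows "I3 \<rho> B \<omega> i j k y z \<le> pair_bound \<omega> n m"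
proof -
  obtain l where l: "norm l \<le> 1" "\<rho> k = bloch_matrix l"
    using assms(4) by (auto simp: qubit_state_def has_bloch_vector_def)
  obtain a b where ab: "\<bar>a\<bar> + norm b \<le> 1" "\<And>n. Re (trace (bloch_matrix n ** B y)) = a + b \<bullet> n"
    using two_outcome_observable_affine[OF assms(5)] by metis
  obtain c d where cd: "\<bar>c\<bar> + norm d \<le> 1" "\<And>n. Re (trace (bloch_matrix n ** B z)) = c + d \<bullet> n"
    using two_outcome_observable_affine[OF assms(6)] by metis
  have "b \<bullet> (n + m) \<le> norm b * norm (n + m)" by (rule norm_cauchy_schwarz)
  also have "\<dots> \<le> 1 * norm (n + m)" using ab(1) by (intro mult_right_mono) auto
  finally have 1: "b \<bullet> (n + m) \<le> norm (n + m)" by simp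
  have "b \<bullet> (- l) \<le> norm b * norm (- l)" by (rule norm_cauchy_schwarz)
  also have "\<dots> \<le> norm b * 1" using l(1) by (intro mult_left_mono) auto
  finally have 2: "- (b \<bullet> l) \<le> norm b" by simp
  have "d \<bullet> (n - m) \<le> norm d * norm (n - m)" by (rule norm_cauchy_schwarz)
  also have "\<dots> \<le> 1 * norm (n - m)" using cd(1) by (intro mult_right_mono) auto
  finally have 3: "d \<bullet> (n - m) \<le> norm (n - m)" by simp
  have "I3 \<rho> B \<omega> i j k y z = \<omega> * (a + b \<bullet> (n + m) - b \<bullet> l) + (1 - \<omega>) * (d \<bullet> (n - m))"
    by (simp add: I3_def correlator_def assms(2,3) l(2) ab(2) cd(2) inner_add_right inner_diff_right)
  also have "\<dots> \<le> \<omega> * (1 + norm (n + m)) + (1 - \<omega>) * norm (n - m)"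
    using assms(1) 1 2 3 ab(1) by (intro add_mono mult_left_mono) auto
  finally show ?thesis by (simp add: pair_bound_def)
qed

text \<open>Cauchy-Schwarz is sharp for \<open>b\<close> along \<open>n + m\<close> and
  \<open>d\<close> along \<open>n - m\<close>; the subtracted state, placed at \<open>- b\<close>,
  contributes the constant 1.\<close>

lemma pair_bound_attained:
  obtains b d :: "real^3" where "norm b = 1" "norm d \<le> 1"
    "pair_bound \<omega> n m =
       \<omega> * (b \<bullet> n + b \<bullet> m - b \<bullet> (- b)) + (1 - \<omega>) * (d \<bullet> n - d \<bullet> m)"
proof -
  have sgn: "sgn v \<bullet> v = norm v" for v :: "real^3"
    by (cases "v = 0") (simp_all add: sgn_div_norm dot_square_norm power2_eq_square)
  \<comment> \<open>The constant 1 comes from \<open>b \<bullet> b\<close>, so \<open>b\<close> must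
    be a unit vector even if \<open>n + m = 0\<close>, where any direction serves. For
    \<open>d\<close> the value \<open>sgn 0 = 0\<close> is harmless.\<close>
  define b :: "real^3" where "b = (if n + m = 0 then axis 1 1 else sgn (n + m))"
  have b: "norm b = 1" "b \<bullet> (n + m) = norm (n + m)"
    by (auto simp: b_def norm_sgn norm_axis_1 sgn)
  have d: "norm (sgn (n - m)) \<le> 1" "sgn (n - m) \<bullet> (n - m) = norm (n - m)"
    by (simp_all add: norm_sgn sgn)
  have "b \<bullet> b = 1" using b(1) by (simp add: dot_square_norm)
  then have "pair_bound \<omega> n m =
      \<omega> * (b \<bullet> n + b \<bullet> m - b \<bullet> (- b)) + (1 - \<omega>) * (sgn (n - m) \<bullet> n - sgn (n - m) \<bullet> m)"
    using b(2) d(2) by (simp add: pair_bound_def inner_add_right inner_diff_right)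
  with b(1) d(1) show thesis by (rule that)
qed

text \<open>Each pair has its own two observables and its own subtracted state, so the three optima
  do not compete.\<close>

lemma I6_attains_pair_bounds:
  obtains \<rho> B where "\<rho> 1 = bloch_matrix n1" "\<rho> 2 = bloch_matrix n2" "\<rho> 3 = bloch_matrix n3"
    "\<forall>x\<in>{4..6}. qubit_state (\<rho> x)" "\<forall>y\<in>{1..6}. two_outcome_observable (B y)"
    "I6 \<rho> B \<omega>12 \<omega>13 \<omega>23 =
       pair_bound \<omega>12 n1 n2 + pair_bound \<omega>13 n1 n3 + pair_bound \<omega>23 n2 n3"
proof -
  obtain b1 d1 where 1: "norm b1 = 1" "norm d1 \<le> 1"
    "pair_bound \<omega>12 n1 n2 =
       \<omega>12 * (b1 \<bullet> n1 + b1 \<bullet> n2 - b1 \<bullet> (- b1)) + (1 - \<omega>12) * (d1 \<bullet> n1 - d1 \<bullet> n2)"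
    by (rule pair_bound_attained)
  obtain b2 d2 where 2: "norm b2 = 1" "norm d2 \<le> 1"
    "pair_bound \<omega>13 n1 n3 =
       \<omega>13 * (b2 \<bullet> n1 + b2 \<bullet> n3 - b2 \<bullet> (- b2)) + (1 - \<omega>13) * (d2 \<bullet> n1 - d2 \<bullet> n3)"
    by (rule pair_bound_attained)
  obtain b3 d3 where 3: "norm b3 = 1" "norm d3 \<le> 1"
    "pair_bound \<omega>23 n2 n3 =
       \<omega>23 * (b3 \<bullet> n2 + b3 \<bullet> n3 - b3 \<bullet> (- b3)) + (1 - \<omega>23) * (d3 \<bullet> n2 - d3 \<bullet> n3)"
    by (rule pair_bound_attained)
  \<comment> \<open>The leading 0 in both lists is padding, since states and observables are
    numbered from 1.\<close>
  define \<rho> where "\<rho> x = bloch_matrix ([0, n1, n2, n3, - b1, - b2, - b3] ! x)" for x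
  define B where "B y = spin_observable ([0, b1, d1, b2, d2, b3, d3] ! y)" for y
  have 456: "{4..6} = {4, 5, 6::nat}" and 16: "{1..6} = {1, 2, 3, 4, 5, 6::nat}"
    by auto
  show thesis
  proof (rule that)
    show "\<rho> 1 = bloch_matrix n1" "\<rho> 2 = bloch_matrix n2" "\<rho> 3 = bloch_matrix n3"
      by (simp_all add: \<rho>_def)
    have "qubit_state (bloch_matrix n)" if "norm n \<le> 1" for n
      using that by (auto simp: qubit_state_def has_bloch_vector_def)
    then show "\<forall>x\<in>{4..6}. qubit_state (\<rho> x)"
      using 1(1) 2(1) 3(1) by (simp add: 456 \<rho>_def)
    show "\<forall>y\<in>{1..6}. two_outcome_observable (B y)"
      using 1 2 3 by (simp add: 16 B_def two_outcome_observable_spin del: One_nat_def)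
    show "I6 \<rho> B \<omega>12 \<omega>13 \<omega>23 =
        pair_bound \<omega>12 n1 n2 + pair_bound \<omega>13 n1 n3 + pair_bound \<omega>23 n2 n3"
      unfolding 1 2 3 by (simp add: I6_def I3_def correlator_def \<rho>_def B_def trace_bloch_spin)
  qed
qed

section \<open>The sharp bound for one pair and its equality case\<close>

lemma weight_norm_pos: "0 < \<omega>\<^sup>2 + (1 - \<omega>)\<^sup>2" for \<omega> :: real
  by (simp add: sum_power2_gt_zero_iff)

text \<open>The parallelogram law puts \<open>(s, d)\<close> in the disc of radius 2, where it is
  paired with \<open>(\<omega>, 1 - \<omega>)\<close>. At equality it is parallel to that weight
  vector and lies on the boundary circle, which determines \<open>d\<close>.\<close>

lemma pair_bound_le:
  assumes "norm n \<le> 1" and "norm m \<le> 1"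
  shows "pair_bound \<omega> n m \<le> \<omega> + 2 * sqrt (\<omega>\<^sup>2 + (1 - \<omega>)\<^sup>2)"
    and "pair_bound \<omega> n m = \<omega> + 2 * sqrt (\<omega>\<^sup>2 + (1 - \<omega>)\<^sup>2) \<Longrightarrow>
      (norm (n - m))\<^sup>2 = 4 * (1 - \<omega>)\<^sup>2 / (\<omega>\<^sup>2 + (1 - \<omega>)\<^sup>2)"
proof -
  define N where "N = \<omega>\<^sup>2 + (1 - \<omega>)\<^sup>2"
  define s d where "s = norm (n + m)" and "d = norm (n - m)"
  have N: "0 < N" unfolding N_def by (rule weight_norm_pos)
  have "s\<^sup>2 + d\<^sup>2 = 2 * ((norm n)\<^sup>2 + (norm m)\<^sup>2)"
    by (simp add: s_def d_def power2_norm_eq_inner inner_simps)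
  also have "\<dots> \<le> 4"
    using power_le_one[OF norm_ge_zero assms(1), of 2] power_le_one[OF norm_ge_zero assms(2), of 2]
    by simp
  finally have sd: "s\<^sup>2 + d\<^sup>2 \<le> 4" .
  \<comment> \<open>Lagrange's identity in the plane: it retains the square that Cauchy-Schwarz
    discards, whose vanishing is the equality case.\<close>
  have lagrange: "(\<omega> * s + (1 - \<omega>) * d)\<^sup>2 + (\<omega> * d - (1 - \<omega>) * s)\<^sup>2 = N * (s\<^sup>2 + d\<^sup>2)"
    by (simp add: N_def power2_eq_square algebra_simps)
  have le: "N * (s\<^sup>2 + d\<^sup>2) \<le> N * 4"
    using N sd by (intro mult_left_mono) auto
  have sq: "(2 * sqrt N)\<^sup>2 = N * 4"
    using N by (simp add: power_mult_distrib)
  have "(\<omega> * s + (1 - \<omega>) * d)\<^sup>2 \<le> (2 * sqrt N)\<^sup>2"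
    unfolding sq using lagrange le zero_le_power2[of "\<omega> * d - (1 - \<omega>) * s"] by linarith
  then have "\<omega> * s + (1 - \<omega>) * d \<le> 2 * sqrt N"
    by (rule power2_le_imp_le) (use N in simp)
  then show "pair_bound \<omega> n m \<le> \<omega> + 2 * sqrt (\<omega>\<^sup>2 + (1 - \<omega>)\<^sup>2)"
    by (simp add: pair_bound_def s_def d_def N_def algebra_simps)
  assume "pair_bound \<omega> n m = \<omega> + 2 * sqrt (\<omega>\<^sup>2 + (1 - \<omega>)\<^sup>2)"
  then have "\<omega> * s + (1 - \<omega>) * d = 2 * sqrt N"
    by (simp add: pair_bound_def s_def d_def N_def algebra_simps)
  then have "N * 4 + (\<omega> * d - (1 - \<omega>) * s)\<^sup>2 = N * (s\<^sup>2 + d\<^sup>2)"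
    using lagrange sq by simp
  then have "(\<omega> * d - (1 - \<omega>) * s)\<^sup>2 = 0" "N * (s\<^sup>2 + d\<^sup>2) = N * 4"
    using le zero_le_power2[of "\<omega> * d - (1 - \<omega>) * s"] by linarith+
  then have eq: "\<omega> * d = (1 - \<omega>) * s" "s\<^sup>2 + d\<^sup>2 = 4"
    using N by simp_all
  have "d\<^sup>2 * N = (\<omega> * d)\<^sup>2 + (1 - \<omega>)\<^sup>2 * d\<^sup>2"
    by (simp add: N_def power2_eq_square algebra_simps)
  also have "\<dots> = (1 - \<omega>)\<^sup>2 * (s\<^sup>2 + d\<^sup>2)"
    by (simp only: eq(1) power_mult_distrib distrib_left)
  finally have "d\<^sup>2 = 4 * (1 - \<omega>)\<^sup>2 / N"
    unfolding eq(2) using N by (simp add: eq_divide_eq)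
  then show "(norm (n - m))\<^sup>2 = 4 * (1 - \<omega>)\<^sup>2 / (\<omega>\<^sup>2 + (1 - \<omega>)\<^sup>2)"
    by (simp add: d_def N_def)
qed

text \<open>With \<open>N = \<omega>\<^sup>2 + (1 - \<omega>)\<^sup>2\<close>, the prescribed inner
  product works because \<open>N + (2 * \<omega> - 1) = 2 * \<omega>\<^sup>2\<close> and
  \<open>N - (2 * \<omega> - 1) = 2 * (1 - \<omega>)\<^sup>2\<close>: the sum and difference norms
  become proportional to the weights.\<close>

lemma pair_bound_optimal:
  assumes "norm n = 1" and "norm m = 1" and "\<omega> \<in> {0..1}"
    and "n \<bullet> m = (2 * \<omega> - 1) / (\<omega>\<^sup>2 + (1 - \<omega>)\<^sup>2)"
  shows "pair_bound \<omega> n m = \<omega> + 2 * sqrt (\<omega>\<^sup>2 + (1 - \<omega>)\<^sup>2)"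
    and "(norm (n - m))\<^sup>2 = 4 * (1 - \<omega>)\<^sup>2 / (\<omega>\<^sup>2 + (1 - \<omega>)\<^sup>2)"
proof -
  define N where "N = \<omega>\<^sup>2 + (1 - \<omega>)\<^sup>2"
  have N: "0 < N" unfolding N_def by (rule weight_norm_pos)
  have c: "n \<bullet> m = (2 * \<omega> - 1) / N" using assms(4) by (simp add: N_def)
  have "(norm (n + m))\<^sup>2 = 2 + 2 * (n \<bullet> m)" "(norm (n - m))\<^sup>2 = 2 - 2 * (n \<bullet> m)"
    using assms(1,2) by (simp_all add: power2_norm_eq_inner inner_simps inner_commute norm_eq_1)
  moreover have "2 + 2 * (n \<bullet> m) = 4 * \<omega>\<^sup>2 / N" "2 - 2 * (n \<bullet> m) = 4 * (1 - \<omega>)\<^sup>2 / N"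
    using N by (simp_all add: c divide_simps) (simp_all add: N_def power2_eq_square algebra_simps)
  ultimately have sd: "(norm (n + m))\<^sup>2 = 4 * \<omega>\<^sup>2 / N" "(norm (n - m))\<^sup>2 = 4 * (1 - \<omega>)\<^sup>2 / N"
    by simp_all
  then show "(norm (n - m))\<^sup>2 = 4 * (1 - \<omega>)\<^sup>2 / (\<omega>\<^sup>2 + (1 - \<omega>)\<^sup>2)"
    by (simp add: N_def)
  have "norm (n + m) = sqrt (4 * \<omega>\<^sup>2 / N)" "norm (n - m) = sqrt (4 * (1 - \<omega>)\<^sup>2 / N)"
    by (metis sd(1) norm_ge_zero real_sqrt_unique, metis sd(2) norm_ge_zero real_sqrt_unique)
  \<comment> \<open>The range of \<open>\<omega>\<close> enters here: both weights are nonnegative,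
    so the roots of their squares are the weights themselves.\<close>
  then have "norm (n + m) = 2 * \<omega> / sqrt N" "norm (n - m) = 2 * (1 - \<omega>) / sqrt N"
    using assms(3) by (simp_all add: real_sqrt_divide real_sqrt_mult)
  then have "pair_bound \<omega> n m = \<omega> + 2 * ((\<omega>\<^sup>2 + (1 - \<omega>)\<^sup>2) / sqrt N)"
    unfolding pair_bound_def
    by (simp only: add_divide_distrib distrib_left power2_eq_square times_divide_eq_right mult_1_right
      mult.left_commute)
  then show "pair_bound \<omega> n m = \<omega> + 2 * sqrt (\<omega>\<^sup>2 + (1 - \<omega>)\<^sup>2)"
    using N by (simp add: real_div_sqrt flip: N_def)
qed

section \<open>Attainment of the mirror-symmetric maximum\<close>

definition mirror_triples :: "((real^3) \<times> (real^3) \<times> (real^3)) set" where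
  "mirror_triples = {(n1, n2, n3). norm n1 \<le> 1 \<and> norm n2 \<le> 1 \<and> norm n3 \<le> 1 \<and>
     (norm (n1 - n2) = norm (n1 - n3) \<or> norm (n1 - n2) = norm (n2 - n3) \<or>
      norm (n1 - n3) = norm (n2 - n3))}"

lemma compact_mirror_triples: "compact mirror_triples"
proof -
  let ?C = "{p :: (real^3) \<times> (real^3) \<times> (real^3).
     norm (fst p - fst (snd p)) = norm (fst p - snd (snd p)) \<or>
     norm (fst p - fst (snd p)) = norm (fst (snd p) - snd (snd p)) \<or>
     norm (fst p - snd (snd p)) = norm (fst (snd p) - snd (snd p))}"
  have closed: "closed ?C"
    by (intro closed_Collect_disj closed_Collect_eq continuous_intros)
  have compact: "compact (cball 0 1 \<times> cball 0 1 \<times> cball 0 1 :: ((real^3) \<times> (real^3) \<times> (real^3)) set)"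
    by (intro compact_Times compact_cball)
  have "mirror_triples = (cball 0 1 \<times> cball 0 1 \<times> cball 0 1) \<inter> ?C"
    by (auto simp: mirror_triples_def)
  then show ?thesis
    using compact_Int_closed[OF compact closed] by (rule ssubst)
qed

text \<open>\<open>GREATEST\<close> is pinned down only by exhibiting a maximum. Once observables
  and auxiliary states are optimised away, the objective is a continuous function on a compact set
  of triples, and its maximiser provides one.\<close>

lemma Q_mirror_attained:
  assumes "\<omega>12 \<in> {0..1}" and "\<omega>13 \<in> {0..1}" and "\<omega>23 \<in> {0..1}"
  obtains n1 n2 n3 where "(n1, n2, n3) \<in> mirror_triples"
    "Q_mirror \<omega>12 \<omega>13 \<omega>23 =
       pair_bound \<omega>12 n1 n2 + pair_bound \<omega>13 n1 n3 + pair_bound \<omega>23 n2 n3"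
proof -
  define F where "F p = pair_bound \<omega>12 (fst p) (fst (snd p)) + pair_bound \<omega>13 (fst p) (snd (snd p))
    + pair_bound \<omega>23 (fst (snd p)) (snd (snd p))" for p
  have "(0, 0, 0) \<in> mirror_triples" by (simp add: mirror_triples_def)
  moreover have "continuous_on mirror_triples F"
    unfolding F_def pair_bound_def by (intro continuous_intros)
  ultimately obtain p where p: "p \<in> mirror_triples" "\<And>q. q \<in> mirror_triples \<Longrightarrow> F q \<le> F p"
    using continuous_attains_sup[OF compact_mirror_triples] by blast
  obtain n1 n2 n3 where p_eq: "p = (n1, n2, n3)" by (cases p)
  have "Q_mirror \<omega>12 \<omega>13 \<omega>23 = F p"
    unfolding Q_mirror_def
  proof (rule Greatest_equality)
    obtain \<rho> B where \<rho>: "\<rho> 1 = bloch_matrix n1" "\<rho> 2 = bloch_matrix n2" "\<rho> 3 = bloch_matrix n3"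
      "\<forall>x\<in>{4..6}. qubit_state (\<rho> x)" "\<forall>y\<in>{1..6}. two_outcome_observable (B y)"
      "I6 \<rho> B \<omega>12 \<omega>13 \<omega>23 =
         pair_bound \<omega>12 n1 n2 + pair_bound \<omega>13 n1 n3 + pair_bound \<omega>23 n2 n3"
      by (rule I6_attains_pair_bounds)
    have bloch: "has_bloch_vector (\<rho> 1) n1" "has_bloch_vector (\<rho> 2) n2" "has_bloch_vector (\<rho> 3) n3"
      using p(1) \<rho>(1-3) by (auto simp: p_eq mirror_triples_def has_bloch_vector_def)
    have "mirror_symmetric (\<rho> 1) (\<rho> 2) (\<rho> 3)"
      unfolding mirror_symmetric_def using bloch p(1) by (auto simp: p_eq mirror_triples_def)
    moreover have "{1..6} = {1, 2, 3} \<union> {4..6::nat}" by auto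
    then have "\<forall>x\<in>{1..6}. qubit_state (\<rho> x)"
      using bloch \<rho>(4) by (auto simp: qubit_state_def simp del: One_nat_def)
    moreover have "F p = I6 \<rho> B \<omega>12 \<omega>13 \<omega>23"
      by (simp add: F_def p_eq \<rho>(6))
    ultimately show "F p \<in> mirror_values \<omega>12 \<omega>13 \<omega>23"
      unfolding mirror_values_def using \<rho>(5) by blast
  next
    fix q assume "q \<in> mirror_values \<omega>12 \<omega>13 \<omega>23"
    then obtain \<rho> B where q: "q = I6 \<rho> B \<omega>12 \<omega>13 \<omega>23" "\<forall>x\<in>{1..6}. qubit_state (\<rho> x)"
        "mirror_symmetric (\<rho> 1) (\<rho> 2) (\<rho> 3)" "\<forall>y\<in>{1..6}. two_outcome_observable (B y)"
      unfolding mirror_values_def by blast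
    from q(3) obtain m1 m2 m3 where m: "has_bloch_vector (\<rho> 1) m1" "has_bloch_vector (\<rho> 2) m2"
        "has_bloch_vector (\<rho> 3) m3" "(m1, m2, m3) \<in> mirror_triples"
      unfolding mirror_symmetric_def mirror_triples_def has_bloch_vector_def by blast
    then have \<rho>: "\<rho> 1 = bloch_matrix m1" "\<rho> 2 = bloch_matrix m2" "\<rho> 3 = bloch_matrix m3"
      by (simp_all add: has_bloch_vector_def)
    have "I3 \<rho> B \<omega>12 1 2 4 1 2 \<le> pair_bound \<omega>12 m1 m2"
      "I3 \<rho> B \<omega>13 1 3 5 3 4 \<le> pair_bound \<omega>13 m1 m3"
      "I3 \<rho> B \<omega>23 2 3 6 5 6 \<le> pair_bound \<omega>23 m2 m3"
      using q(2,4) \<rho> assms by (auto intro!: I3_le_pair_bound simp del: One_nat_def)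
    then have "q \<le> F (m1, m2, m3)"
      by (simp add: q(1) I6_def F_def)
    with p(2)[OF m(4)] show "q \<le> F p" by linarith
  qed
  with p(1) show thesis by (intro that[of n1 n2 n3]) (simp_all add: p_eq F_def)
qed

section \<open>Strict violation by an asymmetric triple\<close>

theorem mainTheorem2:
  fixes n1 n2 n3 :: "real^3" and \<omega>12 \<omega>13 \<omega>23 :: real
  assumes "norm n1 = 1" and "norm n2 = 1" and "norm n3 = 1"
    and "norm (n1 - n2) \<noteq> norm (n1 - n3)"
    and "norm (n1 - n2) \<noteq> norm (n2 - n3)"
    and "norm (n1 - n3) \<noteq> norm (n2 - n3)"
    and "\<omega>12 \<in> {0..1}" and "\<omega>13 \<in> {0..1}" and "\<omega>23 \<in> {0..1}"
    and "n1 \<bullet> n2 = (2 * \<omega>12 - 1) / (\<omega>12\<^sup>2 + (1 - \<omega>12)\<^sup>2)"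
    and "n1 \<bullet> n3 = (2 * \<omega>13 - 1) / (\<omega>13\<^sup>2 + (1 - \<omega>13)\<^sup>2)"
    and "n2 \<bullet> n3 = (2 * \<omega>23 - 1) / (\<omega>23\<^sup>2 + (1 - \<omega>23)\<^sup>2)"
  shows "\<exists>\<rho> B. \<rho> 1 = bloch_matrix n1 \<and> \<rho> 2 = bloch_matrix n2 \<and> \<rho> 3 = bloch_matrix n3 \<and>
           (\<forall>x\<in>{4..6}. qubit_state (\<rho> x)) \<and>
           (\<forall>y\<in>{1..6}. two_outcome_observable (B y)) \<and>
           I6 \<rho> B \<omega>12 \<omega>13 \<omega>23 > Q_mirror \<omega>12 \<omega>13 \<omega>23"
proof -
  have opt12: "pair_bound \<omega>12 n1 n2 = \<omega>12 + 2 * sqrt (\<omega>12\<^sup>2 + (1 - \<omega>12)\<^sup>2)"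
      "(norm (n1 - n2))\<^sup>2 = 4 * (1 - \<omega>12)\<^sup>2 / (\<omega>12\<^sup>2 + (1 - \<omega>12)\<^sup>2)"
    and opt13: "pair_bound \<omega>13 n1 n3 = \<omega>13 + 2 * sqrt (\<omega>13\<^sup>2 + (1 - \<omega>13)\<^sup>2)"
      "(norm (n1 - n3))\<^sup>2 = 4 * (1 - \<omega>13)\<^sup>2 / (\<omega>13\<^sup>2 + (1 - \<omega>13)\<^sup>2)"
    and opt23: "pair_bound \<omega>23 n2 n3 = \<omega>23 + 2 * sqrt (\<omega>23\<^sup>2 + (1 - \<omega>23)\<^sup>2)"
      "(norm (n2 - n3))\<^sup>2 = 4 * (1 - \<omega>23)\<^sup>2 / (\<omega>23\<^sup>2 + (1 - \<omega>23)\<^sup>2)"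
    using assms by (blast intro: pair_bound_optimal)+
  obtain m1 m2 m3 where m: "(m1, m2, m3) \<in> mirror_triples"
      "Q_mirror \<omega>12 \<omega>13 \<omega>23 =
         pair_bound \<omega>12 m1 m2 + pair_bound \<omega>13 m1 m3 + pair_bound \<omega>23 m2 m3"
    using assms by (blast intro: Q_mirror_attained)
  have norms: "norm m1 \<le> 1" "norm m2 \<le> 1" "norm m3 \<le> 1"
    using m(1) by (simp_all add: mirror_triples_def)
  note le = pair_bound_le(1)[OF norms(1,2), of \<omega>12] pair_bound_le(1)[OF norms(1,3), of \<omega>13]
    pair_bound_le(1)[OF norms(2,3), of \<omega>23]
  have gap: "Q_mirror \<omega>12 \<omega>13 \<omega>23 <
      pair_bound \<omega>12 n1 n2 + pair_bound \<omega>13 n1 n3 + pair_bound \<omega>23 n2 n3"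
  proof (rule ccontr)
    assume "\<not> ?thesis"
    \<comment> \<open>Three upper bounds whose sum is reached must each be reached.\<close>
    then have "pair_bound \<omega>12 m1 m2 = \<omega>12 + 2 * sqrt (\<omega>12\<^sup>2 + (1 - \<omega>12)\<^sup>2)"
      "pair_bound \<omega>13 m1 m3 = \<omega>13 + 2 * sqrt (\<omega>13\<^sup>2 + (1 - \<omega>13)\<^sup>2)"
      "pair_bound \<omega>23 m2 m3 = \<omega>23 + 2 * sqrt (\<omega>23\<^sup>2 + (1 - \<omega>23)\<^sup>2)"
      using le unfolding m(2) opt12(1) opt13(1) opt23(1) by linarith+
    \<comment> \<open>For both triples each distance is the same function of the weight, so the
      asymmetry of the \<open>n\<close> triple passes to the mirror-symmetric \<open>m\<close>
      triple.\<close>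
    then have "(norm (m1 - m2))\<^sup>2 = (norm (n1 - n2))\<^sup>2" "(norm (m1 - m3))\<^sup>2 = (norm (n1 - n3))\<^sup>2"
      "(norm (m2 - m3))\<^sup>2 = (norm (n2 - n3))\<^sup>2"
      unfolding opt12(2) opt13(2) opt23(2) using norms by (blast intro: pair_bound_le(2))+
    then have "norm (m1 - m2) = norm (n1 - n2)" "norm (m1 - m3) = norm (n1 - n3)"
      "norm (m2 - m3) = norm (n2 - n3)"
      by simp_all
    then show False
      using m(1) assms(4-6) by (simp add: mirror_triples_def)
  qed
  obtain \<rho> B where "\<rho> 1 = bloch_matrix n1" "\<rho> 2 = bloch_matrix n2" "\<rho> 3 = bloch_matrix n3"
      "\<forall>x\<in>{4..6}. qubit_state (\<rho> x)" "\<forall>y\<in>{1..6}. two_outcome_observable (B y)"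
      "I6 \<rho> B \<omega>12 \<omega>13 \<omega>23 =
         pair_bound \<omega>12 n1 n2 + pair_bound \<omega>13 n1 n3 + pair_bound \<omega>23 n2 n3"
    by (rule I6_attains_pair_bounds)
  with gap show ?thesis
    by (intro exI[of _ \<rho>] exI[of _ B]) simp
qed

end
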